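(* Let $n\ge 1$ and let $A$ be an $n$-by-$n$ complex matrix with $d(A)>\lfloor 2n/3\rfloor$. Then $0$ is a reducing eigenvalue of $A$ with geometric multiplicity at least $3d(A)-2n$ (that is, $\dim(\ker A\cap\ker A^* )\ge 3d(A)-2n$), and $A$ is unitarily similar to a matrix of the form $B\oplus 0_{3d(A)-2n}$, where $B$ is of size $3(n-d(A))$ with $d(B)=2(n-d(A))$. Moreover, the number $\lfloor 2n/3\rfloor$ is sharp: for every $n\ge 1$ there is an $n$-by-$n$ complex matrix $A$ with $d(A)=\lfloor 2n/3\rfloor$ for which $0$ is not a reducing eigenvalue.
   Context: For an $n$-by-$n$ complex matrix $A$, the zero-dilation index $d(A)$ is the largest integer $k\ge 1$ such that there is an $n$-by-$k$ complex matrix $V$ with $V^*V=I_k$ and $V^*AV=0_k$, where $0_k$ is the $k$-by-$k$ zero matrix; if no such $k$ exists, $d(A)=0$. The number $0$ is a reducing eigenvalue of $A$ if $Ax=A^*x=0$ for some nonzero vector $x$. If $d(A)=n$, the matrix $B$ is the empty matrix of size $0$, with $d(B)=0$. *)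

theory Defs
  imports Jordan_Normal_Form.Matrix_Kernel Jordan_Normal_Form.Schur_Decomposition
begin

definition zero_compression :: "complex mat \<Rightarrow> nat \<Rightarrow> bool" where
  "zero_compression A k \<longleftrightarrow>
    (\<exists>V \<in> carrier_mat (dim_row A) k.
      mat_adjoint V * V = 1\<^sub>m k \<and> mat_adjoint V * A * V = 0\<^sub>m k k)"

text \<open>The greatest element is attained: \<open>V\<^sup>* V = I\<^sub>k\<close> forces \<open>k \<le> n\<close> for an
  \<open>n\<close>-by-\<open>n\<close> matrix. The empty matrix gets index 0.\<close>

definition zero_dilation_index :: "complex mat \<Rightarrow> nat" where
  "zero_dilation_index A =
    (if \<exists>k\<ge>1. zero_compression A k then GREATEST k. k \<ge> 1 \<and> zero_compression A k else 0)"

definition zero_reducing_eigenvalue :: "complex mat \<Rightarrow> bool" where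
  "zero_reducing_eigenvalue A \<longleftrightarrow>
    (\<exists>x \<in> carrier_vec (dim_row A). x \<noteq> 0\<^sub>v (dim_row A) \<and>
      A *\<^sub>v x = 0\<^sub>v (dim_row A) \<and> mat_adjoint A *\<^sub>v x = 0\<^sub>v (dim_row A))"

definition zero_reducing_multiplicity :: "complex mat \<Rightarrow> nat" where
  "zero_reducing_multiplicity A =
    vectorspace.dim class_ring
      ((module_vec TYPE(complex) (dim_row A))
        \<lparr>carrier := mat_kernel A \<inter> mat_kernel (mat_adjoint A)\<rparr>)"

text \<open>The witnesses \<open>U\<close> and \<open>U\<^sup>*\<close> of \<^const>\<open>similar_mat_wit\<close> are square and mutually
  inverse, so \<open>U\<close> is unitary and \<open>A = U B U\<^sup>*\<close>.\<close>

definition unitarily_similar :: "complex mat \<Rightarrow> complex mat \<Rightarrow> bool" where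
  "unitarily_similar A B \<longleftrightarrow> (\<exists>U. similar_mat_wit A B U (mat_adjoint U))"

end

theory Submission
  imports Defs
begin

text \<open>Let \<open>d = d(A)\<close>, let \<open>V\<close> be a \<open>d\<close>-dimensional subspace on which \<open>A\<close> compresses to \<open>0\<close>, and
  let \<open>W\<close> be its orthogonal complement, of dimension \<open>n - d\<close>. A vector \<open>z\<close> orthogonal to \<open>W\<close>,
  \<open>A W\<close> and \<open>A\<^sup>* W\<close> lies in \<open>V\<close>, so \<open>A z\<close> and \<open>A\<^sup>* z\<close> are orthogonal to \<open>V\<close> as well as to \<open>W\<close> and
  hence vanish. These are \<open>3 (n - d)\<close> conditions, which leaves dimension at least \<open>3 d - 2 n\<close>.
  Splitting off \<open>3 d - 2 n\<close> such directions leaves a block \<open>B\<close> on the span of \<open>W\<close> and \<open>2 (n - d)\<close>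
  directions of \<open>V\<close>; a larger zero compression of \<open>B\<close> would, joined with the kernel, contradict
  the maximality of \<open>d\<close>. For sharpness it is enough to exhibit a zero compression of size
  \<open>\<lfloor>2 n / 3\<rfloor>\<close> in a matrix without common kernel: by the first part its index cannot be larger.\<close>

section \<open>Kernels of wide matrices, adjoints and the complex inner product\<close>

lemma wide_matrix_kernel:
  fixes M :: "'a :: field mat"
  assumes M: "M \<in> carrier_mat p d" and "p < d"
  shows "\<exists>x \<in> carrier_vec d. x \<noteq> 0\<^sub>v d \<and> M *\<^sub>v x = 0\<^sub>v p"
proof -
  \<comment> \<open>\<open>M\<close> is padded with zero rows to a square matrix. Row
    \<open>p\<close> is one of them because \<open>p < d\<close>, so the determinant vanishes and a
    nonzero kernel vector exists; its first \<open>p\<close> equations are those of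
    \<open>M\<close>. The row \<open>p\<close> is singled out to match the shape of
    \<open>det_row_0\<close>.\<close>
  let ?N = "mat\<^sub>r d d (\<lambda>i. if i = p then 0\<^sub>v d else if i < p then row M i else 0\<^sub>v d)"
  have N: "?N \<in> carrier_mat d d" by simp
  have "det ?N = 0"
    by (rule det_row_0) (use assms in auto)
  then obtain x where x: "x \<in> carrier_vec d" "x \<noteq> 0\<^sub>v d" "?N *\<^sub>v x = 0\<^sub>v d"
    using det_0_iff_vec_prod_zero_field[OF N] by blast
  have "M *\<^sub>v x = 0\<^sub>v p"
  proof (rule eq_vecI)
    fix i assume i: "i < dim_vec (0\<^sub>v p :: 'a vec)"
    have "(?N *\<^sub>v x) $ i = 0" using x(3) i assms by simp
    thus "(M *\<^sub>v x) $ i = 0\<^sub>v p $ i" using i assms by simp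
  qed (use M in auto)
  with x show ?thesis by blast
qed

lemma mat_adjoint_carrier [simp, intro]:
  "A \<in> carrier_mat n m \<Longrightarrow> mat_adjoint A \<in> carrier_mat m n"
  by (simp add: mat_adjoint_def mat_of_rows_def)

lemma mat_adjoint_mult_vec_carrier [simp, intro]:
  "A \<in> carrier_mat n m \<Longrightarrow> x \<in> carrier_vec n \<Longrightarrow> mat_adjoint A *\<^sub>v x \<in> carrier_vec m"
  by (rule mult_mat_vec_carrier) auto

lemma mat_adjoint_dim [simp]:
  "dim_row (mat_adjoint A) = dim_col A" "dim_col (mat_adjoint A) = dim_row A"
  by (simp_all add: mat_adjoint_def)

lemma mat_adjoint_index [simp]:
  "i < dim_col A \<Longrightarrow> j < dim_row A \<Longrightarrow> mat_adjoint A $$ (i, j) = conjugate (A $$ (j, i))"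
  by (simp add: mat_adjoint_def mat_of_rows_index)

lemma mat_adjoint_adjoint [simp]: "mat_adjoint (mat_adjoint A) = A"
  by (rule eq_matI) auto

lemma cscalar_prod_mult_mat_vec:
  fixes A :: "complex mat"
  assumes "A \<in> carrier_mat n m" "x \<in> carrier_vec m" "y \<in> carrier_vec n"
  shows "(A *\<^sub>v x) \<bullet>c y = x \<bullet>c (mat_adjoint A *\<^sub>v y)"
proof -
  have "(A *\<^sub>v x) \<bullet>c y = (\<Sum>i<n. \<Sum>j<m. A $$ (i, j) * x $ j * cnj (y $ i))"
    using assms by (auto simp: scalar_prod_def sum_distrib_right lessThan_atLeast0 intro!: sum.cong)
  also have "\<dots> = (\<Sum>j<m. \<Sum>i<n. A $$ (i, j) * x $ j * cnj (y $ i))"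
    by (rule sum.swap)
  also have "\<dots> = x \<bullet>c (mat_adjoint A *\<^sub>v y)"
    using assms by (auto simp: scalar_prod_def sum_distrib_left lessThan_atLeast0 ac_simps
        intro!: sum.cong)
  finally show ?thesis .
qed

lemma cscalar_prod_commute:
  fixes x y :: "complex vec"
  assumes "x \<in> carrier_vec n" "y \<in> carrier_vec n"
  shows "x \<bullet>c y = cnj (y \<bullet>c x)"
  using assms by (auto simp: scalar_prod_def ac_simps intro!: sum.cong)

lemma cscalar_prod_commute_0:
  fixes x y :: "complex vec"
  assumes "x \<in> carrier_vec n" "y \<in> carrier_vec n" "x \<bullet>c y = 0"
  shows "y \<bullet>c x = 0"
  using cscalar_prod_commute[of x n y] assms by simp

lemma mat_adjoint_mult_vec_index:
  fixes X :: "complex mat"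
  assumes "X \<in> carrier_mat n k" "u \<in> carrier_vec n" "i < k"
  shows "(mat_adjoint X *\<^sub>v u) $ i = u \<bullet>c col X i"
  using assms by (auto simp: scalar_prod_def ac_simps intro!: sum.cong)

lemma mat_adjoint_mult_index:
  fixes X :: "complex mat"
  assumes "X \<in> carrier_mat n k" "M \<in> carrier_mat n l" "i < k" "j < l"
  shows "(mat_adjoint X * M) $$ (i, j) = col M j \<bullet>c col X i"
  using assms by (auto simp: scalar_prod_def ac_simps intro!: sum.cong)

text \<open>Lets a compression be read through the sesquilinear form of \<open>A\<close> on the
  columns of \<open>X\<close>. The inner product conjugates its second argument, so the row index
  goes there.\<close>

lemma compression_index:
  fixes A :: "complex mat"
  assumes A: "A \<in> carrier_mat n n" and X: "X \<in> carrier_mat n k" and ij: "i < k" "j < k"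
  shows "(mat_adjoint X * A * X) $$ (i, j) = (A *\<^sub>v col X j) \<bullet>c col X i"
proof -
  have "mat_adjoint X * A * X = mat_adjoint X * (A * X)"
    using assms by (intro assoc_mult_mat) auto
  thus ?thesis
    using mat_adjoint_mult_index[of X n k "A * X" k i j] assms by (simp add: col_mult2[OF A X ij(2)])
qed

lemma conjugate_unit_vec: "conjugate (unit_vec n i) = (unit_vec n i :: complex vec)"
  by (rule eq_vecI) (auto simp: unit_vec_def)

lemma mat_form_unit_vec:
  fixes A :: "complex mat"
  assumes A: "A \<in> carrier_mat n n" and "i < n" "j < n"
  shows "(A *\<^sub>v unit_vec n j) \<bullet>c unit_vec n i = A $$ (i, j)"
  using assms by (simp add: conjugate_unit_vec)

section \<open>Orthonormal lists, bases and orthogonal complements\<close>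

text \<open>A list rather than a set: its order fixes the columns of a matrix, its length is the
  dimension of the span, and the condition on indices forces distinct entries.\<close>

definition orthonormal :: "nat \<Rightarrow> complex vec list \<Rightarrow> bool" where
  "orthonormal n xs \<longleftrightarrow> set xs \<subseteq> carrier_vec n \<and>
    (\<forall>i<length xs. \<forall>j<length xs. xs ! i \<bullet>c xs ! j = (if i = j then 1 else 0))"

lemma orthonormal_carrier: "orthonormal n xs \<Longrightarrow> set xs \<subseteq> carrier_vec n"
  by (simp add: orthonormal_def)

lemma orthonormal_nth:
  "orthonormal n xs \<Longrightarrow> i < length xs \<Longrightarrow> j < length xs \<Longrightarrow>
    xs ! i \<bullet>c xs ! j = (if i = j then 1 else 0)"
  by (simp add: orthonormal_def)

lemma orthonormal_Nil [simp]: "orthonormal n []"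
  by (simp add: orthonormal_def)

lemma orthonormal_unit_vecs:
  assumes "d \<le> n"
  shows "orthonormal n (map (unit_vec n) [0..<d])"
  unfolding orthonormal_def
proof (intro conjI allI impI)
  fix i j assume "i < length (map (unit_vec n) [0..<d])" "j < length (map (unit_vec n) [0..<d])"
  hence "i < d" "j < d" by simp_all
  thus "map (unit_vec n) [0..<d] ! i \<bullet>c map (unit_vec n) [0..<d] ! j = (if i = j then 1 else (0 :: complex))"
    using assms by (simp add: conjugate_unit_vec)
qed auto

lemma orthonormal_append:
  "orthonormal n (xs @ ys) \<longleftrightarrow>
    orthonormal n xs \<and> orthonormal n ys \<and> (\<forall>x \<in> set xs. \<forall>y \<in> set ys. x \<bullet>c y = 0)"
  (is "?l \<longleftrightarrow> ?r")
proof
  assume l: ?l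
  have "orthonormal n xs"
    unfolding orthonormal_def
  proof (intro conjI allI impI)
    fix i j assume "i < length xs" "j < length xs"
    thus "xs ! i \<bullet>c xs ! j = (if i = j then 1 else 0)"
      using orthonormal_nth[OF l, of i j] by (simp add: nth_append)
  qed (use orthonormal_carrier[OF l] in auto)
  moreover have "orthonormal n ys"
    unfolding orthonormal_def
  proof (intro conjI allI impI)
    fix i j assume "i < length ys" "j < length ys"
    thus "ys ! i \<bullet>c ys ! j = (if i = j then 1 else 0)"
      using orthonormal_nth[OF l, of "length xs + i" "length xs + j"] by (simp add: nth_append)
  qed (use orthonormal_carrier[OF l] in auto)
  moreover have "x \<bullet>c y = 0" if xy: "x \<in> set xs" "y \<in> set ys" for x y
  proof -
    from xy obtain i j where "i < length xs" "x = xs ! i" "j < length ys" "y = ys ! j"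
      by (auto simp: in_set_conv_nth)
    thus ?thesis
      using orthonormal_nth[OF l, of i "length xs + j"] by (simp add: nth_append)
  qed
  ultimately show ?r by blast
next
  assume r: ?r
  hence c: "set xs \<subseteq> carrier_vec n" "set ys \<subseteq> carrier_vec n"
    by (auto dest: orthonormal_carrier)
  have 0: "xs ! i \<bullet>c ys ! j = 0 \<and> ys ! j \<bullet>c xs ! i = 0" if "i < length xs" "j < length ys" for i j
  proof -
    have "xs ! i \<in> carrier_vec n" "ys ! j \<in> carrier_vec n" "xs ! i \<bullet>c ys ! j = 0"
      using r c that by (meson nth_mem subsetD)+
    thus ?thesis using cscalar_prod_commute_0 by blast
  qed
  show ?l
    unfolding orthonormal_def
  proof (intro conjI allI impI)
    fix i j assume ij: "i < length (xs @ ys)" "j < length (xs @ ys)"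
    have "xs ! i \<bullet>c xs ! j = (if i = j then 1 else 0)" if "i < length xs" "j < length xs"
      using r that by (auto simp: orthonormal_nth)
    moreover have "ys ! (i - length xs) \<bullet>c ys ! (j - length xs) = (if i = j then 1 else 0)"
      if "\<not> i < length xs" "\<not> j < length xs"
      using r that ij by (auto simp: orthonormal_nth)
    ultimately show "(xs @ ys) ! i \<bullet>c (xs @ ys) ! j = (if i = j then 1 else 0)"
      using 0[of i "j - length xs"] 0[of j "i - length xs"] ij
      by (cases "i < length xs"; cases "j < length xs") (auto simp: nth_append)
  qed (use c in auto)
qed

lemma orthonormal_swap: "orthonormal n (xs @ ys) \<Longrightarrow> orthonormal n (ys @ xs)"
proof -
  assume "orthonormal n (xs @ ys)"
  hence *: "orthonormal n xs" "orthonormal n ys" "\<And>x y. x \<in> set xs \<Longrightarrow> y \<in> set ys \<Longrightarrow> x \<bullet>c y = 0"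
    by (auto simp: orthonormal_append)
  have "y \<bullet>c x = 0" if "x \<in> set xs" "y \<in> set ys" for x y
    using *(3)[OF that] that *(1,2) orthonormal_carrier
    by - (rule cscalar_prod_commute_0[of x n y], blast+)
  thus ?thesis using * by (simp add: orthonormal_append)
qed

text \<open>The product is the Gram matrix of the list, up to transposition. This is the bridge
  between the matrices \<open>V\<close> in \<open>zero_compression\<close> and lists of
  vectors.\<close>

lemma orthonormal_iff_isometry:
  assumes "set xs \<subseteq> carrier_vec n"
  shows "orthonormal n xs \<longleftrightarrow>
    mat_adjoint (mat_of_cols n xs) * mat_of_cols n xs = 1\<^sub>m (length xs)"
proof -
  let ?X = "mat_of_cols n xs"
  have X: "?X \<in> carrier_mat n (length xs)" by simp
  have *: "(mat_adjoint ?X * ?X) $$ (i, j) = xs ! j \<bullet>c xs ! i"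
    if "i < length xs" "j < length xs" for i j
    using mat_adjoint_mult_index[OF X X that] that assms
    by (metis col_mat_of_cols nth_mem subsetD)
  show ?thesis
  proof
    assume o: "orthonormal n xs"
    show "mat_adjoint ?X * ?X = 1\<^sub>m (length xs)"
    proof (rule eq_matI)
      fix i j assume "i < dim_row (1\<^sub>m (length xs) :: complex mat)" 
        "j < dim_col (1\<^sub>m (length xs) :: complex mat)"
      thus "(mat_adjoint ?X * ?X) $$ (i, j) = 1\<^sub>m (length xs) $$ (i, j)"
        using *[of i j] orthonormal_nth[OF o, of j i] by auto
    qed auto
  next
    assume e: "mat_adjoint ?X * ?X = 1\<^sub>m (length xs)"
    show "orthonormal n xs"
      unfolding orthonormal_def
    proof (intro conjI allI impI)
      fix i j assume "i < length xs" "j < length xs"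
      thus "xs ! i \<bullet>c xs ! j = (if i = j then 1 else 0)"
        using *[of j i] unfolding e by auto
    qed (fact assms)
  qed
qed

text \<open>A longer family would give a wide matrix, which has a nonzero kernel, whereas an
  isometry is injective.\<close>

lemma orthonormal_length:
  assumes o: "orthonormal n xs"
  shows "length xs \<le> n"
proof (rule ccontr)
  let ?X = "mat_of_cols n xs" and ?k = "length xs"
  have X: "?X \<in> carrier_mat n ?k" by simp
  assume "\<not> ?thesis"
  then obtain x where x: "x \<in> carrier_vec ?k" "x \<noteq> 0\<^sub>v ?k" "?X *\<^sub>v x = 0\<^sub>v n"
    using wide_matrix_kernel[OF X] by auto
  have "x = mat_adjoint ?X * ?X *\<^sub>v x"
    using o orthonormal_iff_isometry[OF orthonormal_carrier[OF o]] x by simp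
  also have "\<dots> = mat_adjoint ?X *\<^sub>v (?X *\<^sub>v x)"
    using x by (intro assoc_mult_mat_vec) auto
  also have "\<dots> = 0\<^sub>v ?k"
    unfolding x(3) by (intro eq_vecI) auto
  finally show False using x by simp
qed

text \<open>The conditions form a homogeneous system with fewer equations than unknowns. Only the
  number of vectors in \<open>cs\<close> counts: they may be dependent, repeated or zero.\<close>

lemma exists_orthogonal_unit_vector:
  assumes cs: "set cs \<subseteq> carrier_vec n" and l: "length cs < n"
  shows "\<exists>x :: complex vec \<in> carrier_vec n. x \<bullet>c x = 1 \<and> (\<forall>c \<in> set cs. x \<bullet>c c = 0)"
proof -
  let ?C = "mat_of_cols n cs"
  have C: "?C \<in> carrier_mat n (length cs)" by simp
  obtain x where x: "x \<in> carrier_vec n" "x \<noteq> 0\<^sub>v n" "mat_adjoint ?C *\<^sub>v x = 0\<^sub>v (length cs)"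
    using wide_matrix_kernel[of "mat_adjoint ?C" "length cs" n] l by auto
  have perp: "x \<bullet>c c = 0" if "c \<in> set cs" for c
  proof -
    from that obtain i where i: "i < length cs" "c = cs ! i" by (auto simp: in_set_conv_nth)
    have "x \<bullet>c col ?C i = 0"
      using mat_adjoint_mult_vec_index[OF C x(1) i(1)] x(3) i by simp
    moreover have "col ?C i = c" using i cs that by (metis col_mat_of_cols subsetD)
    ultimately show ?thesis by simp
  qed
  \<comment> \<open>In the order on the complex numbers a positive number is real, so the real
    square root of \<open>r\<close> can serve for normalization.\<close>
  define r where "r = Re (x \<bullet>c x)"
  have "x \<bullet>c x > 0" using x conjugate_square_greater_0_vec by blast
  hence r: "r > 0" "x \<bullet>c x = of_real r"
    by (auto simp: r_def less_complex_def complex_eq_iff)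
  define y where "y = of_real (1 / sqrt r) \<cdot>\<^sub>v x"
  have "y \<bullet>c y = of_real (1 / sqrt r) * (of_real (1 / sqrt r) * (x \<bullet>c x))"
    using x by (simp add: y_def conjugate_smult_vec)
  also have "\<dots> = of_real ((1 / sqrt r) * ((1 / sqrt r) * r))"
    unfolding r(2) by (simp only: of_real_mult)
  also have "(1 / sqrt r) * ((1 / sqrt r) * r) = 1"
    using r(1) by (simp add: field_simps)
  finally have "y \<bullet>c y = 1" by simp
  moreover have "y \<in> carrier_vec n" using x by (simp add: y_def)
  moreover have "y \<bullet>c c = 0" if "c \<in> set cs" for c
    using perp[OF that] x cs that by (auto simp: y_def)
  ultimately show ?thesis by blast
qed

text \<open>Greedy choice: at each stage the vectors of \<open>cs\<close> and \<open>xs\<close> and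
  those already chosen number fewer than \<open>n\<close>. With \<open>cs\<close> empty this extends
  a family towards a basis; with \<open>xs\<close> empty it finds an orthonormal family inside the
  complement of \<open>cs\<close>.\<close>

lemma orthonormal_extend:
  assumes "orthonormal n xs" "set cs \<subseteq> carrier_vec n" "length cs + length xs + k \<le> n"
  shows "\<exists>ys. length ys = k \<and> orthonormal n (xs @ ys) \<and> (\<forall>y \<in> set ys. \<forall>c \<in> set cs. y \<bullet>c c = 0)"
  using assms(3)
proof (induction k)
  case 0
  then show ?case using assms by (intro exI[of _ "[]"]) simp
next
  case (Suc k)
  then obtain ys where ys: "length ys = k" "orthonormal n (xs @ ys)"
    "\<forall>y \<in> set ys. \<forall>c \<in> set cs. y \<bullet>c c = 0" by auto
  have zs: "set (xs @ ys) \<subseteq> carrier_vec n" using orthonormal_carrier[OF ys(2)] .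
  have "set (cs @ xs @ ys) \<subseteq> carrier_vec n" "length (cs @ xs @ ys) < n"
    using zs assms(2) ys(1) Suc.prems by auto
  from exists_orthogonal_unit_vector[OF this]
  obtain y :: "complex vec" where y: "y \<in> carrier_vec n" "y \<bullet>c y = 1"
    "\<forall>c \<in> set (cs @ xs @ ys). y \<bullet>c c = 0" by blast
  have "orthonormal n [y]" using y by (simp add: orthonormal_def)
  hence "orthonormal n ([y] @ xs @ ys)"
    unfolding orthonormal_append[of n "[y]"] using ys(2) y(3) by auto
  hence "orthonormal n (xs @ ys @ [y])" using orthonormal_swap[of n "[y]" "xs @ ys"] by simp
  thus ?case using ys y by (intro exI[of _ "ys @ [y]"]) auto
qed

lemma orthonormal_basis_unitary:
  assumes o: "orthonormal n xs" and l: "length xs = n"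
  shows "mat_of_cols n xs * mat_adjoint (mat_of_cols n xs) = 1\<^sub>m n"
proof (rule mat_mult_left_right_inverse)
  show U: "mat_of_cols n xs \<in> carrier_mat n n" using l by auto
  show "mat_adjoint (mat_of_cols n xs) \<in> carrier_mat n n" using U by (rule mat_adjoint_carrier)
  show "mat_adjoint (mat_of_cols n xs) * mat_of_cols n xs = 1\<^sub>m n"
    using o l orthonormal_iff_isometry[OF orthonormal_carrier[OF o]] by simp
qed

text \<open>The coordinates of \<open>u\<close> are the entries of the adjoint of \<open>?U\<close>
  applied to \<open>u\<close>. Inserting \<open>?U\<close> times its adjoint in front of
  \<open>u\<close> and moving \<open>?U\<close> across the inner product leaves the product of the
  coordinate vectors.\<close>

lemma parseval:
  assumes o: "orthonormal n xs" and l: "length xs = n"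
    and u: "u \<in> carrier_vec n" and v: "v \<in> carrier_vec n"
  shows "u \<bullet>c v = (\<Sum>i<n. (u \<bullet>c xs ! i) * cnj (v \<bullet>c xs ! i))"
proof -
  let ?U = "mat_of_cols n xs"
  have U: "?U \<in> carrier_mat n n" using l by auto
  have c: "col ?U i = xs ! i" if "i < n" for i
    using that l orthonormal_carrier[OF o] by (intro col_mat_of_cols) auto
  have "u = ?U * mat_adjoint ?U *\<^sub>v u"
    using u by (simp add: orthonormal_basis_unitary[OF o l])
  also have "\<dots> = ?U *\<^sub>v (mat_adjoint ?U *\<^sub>v u)"
    using U u by (intro assoc_mult_mat_vec) auto
  finally have "u \<bullet>c v = (?U *\<^sub>v (mat_adjoint ?U *\<^sub>v u)) \<bullet>c v" by simp
  also have "\<dots> = (mat_adjoint ?U *\<^sub>v u) \<bullet>c (mat_adjoint ?U *\<^sub>v v)"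
    by (rule cscalar_prod_mult_mat_vec[OF U]) (use U u v in auto)
  also have "\<dots> = (\<Sum>i<n. (mat_adjoint ?U *\<^sub>v u) $ i * cnj ((mat_adjoint ?U *\<^sub>v v) $ i))"
    using U l by (auto simp: scalar_prod_def lessThan_atLeast0 simp del: index_mult_mat_vec)
  also have "\<dots> = (\<Sum>i<n. (u \<bullet>c xs ! i) * cnj (v \<bullet>c xs ! i))"
    by (rule sum.cong)
      (simp_all add: mat_adjoint_mult_vec_index[OF U u] mat_adjoint_mult_vec_index[OF U v] c
        del: index_mult_mat_vec)
  finally show ?thesis .
qed

lemma orthonormal_basis_eq_0:
  assumes o: "orthonormal n xs" and l: "length xs = n" and u: "u \<in> carrier_vec n"
    and 0: "\<And>x. x \<in> set xs \<Longrightarrow> u \<bullet>c x = 0"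
  shows "u = 0\<^sub>v n"
proof -
  have "u \<bullet>c u = 0" using parseval[OF o l u u] 0 l by simp
  thus ?thesis using u by simp
qed

text \<open>Each term of the Parseval sum has a vanishing factor, from \<open>u\<close> at the
  indices of \<open>vs\<close> and from \<open>y\<close> at those of \<open>ws\<close>. This lets
  orthogonality to \<open>ws\<close> stand for membership in the span of \<open>vs\<close>.\<close>

lemma orthogonal_complement_cscalar_prod:
  assumes o: "orthonormal n (vs @ ws)" and l: "length (vs @ ws) = n"
    and u: "u \<in> carrier_vec n" "\<And>v. v \<in> set vs \<Longrightarrow> u \<bullet>c v = 0"
    and y: "y \<in> carrier_vec n" "\<And>w. w \<in> set ws \<Longrightarrow> y \<bullet>c w = 0"
  shows "u \<bullet>c y = 0"
proof -
  have "(u \<bullet>c (vs @ ws) ! i) * cnj (y \<bullet>c (vs @ ws) ! i) = 0" if "i < n" for i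
    using that l u y by (cases "i < length vs") (auto simp: nth_append)
  thus ?thesis unfolding parseval[OF o l u(1) y(1)] by (intro sum.neutral) blast
qed

text \<open>The form \<open>(A y, y')\<close> vanishes on the span of \<open>vs\<close>, described as the complement
  of \<open>ws\<close>.\<close>

lemma compression_on_span:
  fixes A :: "complex mat"
  assumes A: "A \<in> carrier_mat n n" and o: "orthonormal n (vs @ ws)" and l: "length (vs @ ws) = n"
    and z: "\<And>v v'. v \<in> set vs \<Longrightarrow> v' \<in> set vs \<Longrightarrow> (A *\<^sub>v v) \<bullet>c v' = 0"
    and y: "y \<in> carrier_vec n" "\<And>w. w \<in> set ws \<Longrightarrow> y \<bullet>c w = 0"
    and y': "y' \<in> carrier_vec n" "\<And>w. w \<in> set ws \<Longrightarrow> y' \<bullet>c w = 0"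
  shows "(A *\<^sub>v y) \<bullet>c y' = 0"
proof -
  note c = orthonormal_carrier[OF o]
  \<comment> \<open>The two arguments are extended one after the other. For fixed \<open>v'\<close>
    in \<open>vs\<close>, the adjoint of \<open>A\<close> maps \<open>v'\<close> to a vector
    orthogonal to all of \<open>vs\<close>, hence to \<open>y\<close>; then \<open>A\<close> maps
    \<open>y\<close> to a vector orthogonal to \<open>vs\<close>, hence to
    \<open>y'\<close>.\<close>
  have "(A *\<^sub>v y) \<bullet>c v' = 0" if v': "v' \<in> set vs" for v'
  proof -
    have cv': "v' \<in> carrier_vec n" using c v' by auto
    have "(mat_adjoint A *\<^sub>v v') \<bullet>c y = 0"
    proof (rule orthogonal_complement_cscalar_prod[OF o l _ _ y])
      fix v assume v: "v \<in> set vs"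
      hence cv: "v \<in> carrier_vec n" using c by auto
      have "v \<bullet>c (mat_adjoint A *\<^sub>v v') = 0"
        using z[OF v v'] cscalar_prod_mult_mat_vec[OF A cv cv'] by simp
      thus "(mat_adjoint A *\<^sub>v v') \<bullet>c v = 0"
        using A cv cv' by - (rule cscalar_prod_commute_0[of v n], auto)
    qed (use A cv' in auto)
    hence "y \<bullet>c (mat_adjoint A *\<^sub>v v') = 0"
      using A y cv' by - (rule cscalar_prod_commute_0[of _ n y], auto)
    thus ?thesis using cscalar_prod_mult_mat_vec[OF A y(1) cv'] by simp
  qed
  moreover have "A *\<^sub>v y \<in> carrier_vec n" using A y(1) by simp
  ultimately show ?thesis
    using orthogonal_complement_cscalar_prod[OF o l _ _ y'] by blast
qed

section \<open>Zero compressions and the zero-dilation index\<close>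

lemma zero_compression_iff_orthonormal:
  assumes A: "A \<in> carrier_mat n n"
  shows "zero_compression A k \<longleftrightarrow>
    (\<exists>vs. length vs = k \<and> orthonormal n vs \<and> (\<forall>v \<in> set vs. \<forall>v' \<in> set vs. (A *\<^sub>v v) \<bullet>c v' = 0))"
  (is "_ \<longleftrightarrow> ?r")
proof
  assume "zero_compression A k"
  then obtain V where V: "V \<in> carrier_mat n k" "mat_adjoint V * V = 1\<^sub>m k"
    "mat_adjoint V * A * V = 0\<^sub>m k k" using A by (auto simp: zero_compression_def)
  have "(A *\<^sub>v v) \<bullet>c v' = 0" if "v \<in> set (cols V)" "v' \<in> set (cols V)" for v v'
  proof -
    from that V(1) obtain i j where "i < k" "j < k" "v = col V j" "v' = col V i"
      by (auto simp: in_set_conv_nth)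
    thus ?thesis using compression_index[OF A V(1), of i j] V(3) by simp
  qed
  moreover have "mat_of_cols n (cols V) = V" using V by auto
  ultimately show ?r
    using V orthonormal_iff_isometry[of "cols V" n] cols_dim[of V]
    by (intro exI[of _ "cols V"]) auto
next
  assume ?r
  then obtain vs where vs: "length vs = k" "orthonormal n vs"
    "\<forall>v \<in> set vs. \<forall>v' \<in> set vs. (A *\<^sub>v v) \<bullet>c v' = 0" by blast
  let ?V = "mat_of_cols n vs"
  have V: "?V \<in> carrier_mat n k" using vs by auto
  have c: "col ?V i = vs ! i" if "i < k" for i
    using that vs orthonormal_carrier[OF vs(2)] by (intro col_mat_of_cols) auto
  have "mat_adjoint ?V * A * ?V = 0\<^sub>m k k"
    by (rule eq_matI) (use compression_index[OF A V] c vs V in auto)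
  moreover have "mat_adjoint ?V * ?V = 1\<^sub>m k"
    using orthonormal_iff_isometry[OF orthonormal_carrier[OF vs(2)]] vs by simp
  ultimately show "zero_compression A k"
    unfolding zero_compression_def using V A by auto
qed

lemma zero_compression_le:
  assumes "A \<in> carrier_mat n n" "zero_compression A k"
  shows "k \<le> n"
  using assms(2) orthonormal_length unfolding zero_compression_iff_orthonormal[OF assms(1)] by blast

text \<open>The bound by \<open>n\<close> makes \<open>GREATEST\<close> an attained maximum. The
  default index 0 also fits, since the empty list is a zero compression of size 0.\<close>

lemma zero_compression_index:
  assumes A: "A \<in> carrier_mat n n"
  shows "zero_compression A (zero_dilation_index A)"
proof (cases "\<exists>k\<ge>1. zero_compression A k")
  case True
  then obtain k where k: "k \<ge> 1 \<and> zero_compression A k" by blast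
  show ?thesis
    using GreatestI_nat[of "\<lambda>k. k \<ge> 1 \<and> zero_compression A k", OF k] zero_compression_le[OF A] k
    by (auto simp: zero_dilation_index_def)
next
  case False
  have "zero_compression A 0" by (simp add: zero_compression_iff_orthonormal[OF A])
  thus ?thesis using False by (auto simp: zero_dilation_index_def)
qed

lemma zero_compression_le_index:
  assumes A: "A \<in> carrier_mat n n" and k: "zero_compression A k"
  shows "k \<le> zero_dilation_index A"
proof (cases "k \<ge> 1")
  case True
  hence k': "k \<ge> 1 \<and> zero_compression A k" using k by simp
  show ?thesis
    using Greatest_le_nat[of "\<lambda>k. k \<ge> 1 \<and> zero_compression A k", OF k'] zero_compression_le[OF A] k'
    by (auto simp: zero_dilation_index_def)
qed simp

section \<open>Common kernel vectors: multiplicity, change of basis and joining with a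
  compression\<close>

lemma zero_reducing_multiplicity_ge:
  assumes cA: "A \<in> carrier_mat n n" and o: "orthonormal n zs"
    and z: "\<And>z. z \<in> set zs \<Longrightarrow> A *\<^sub>v z = 0\<^sub>v n \<and> mat_adjoint A *\<^sub>v z = 0\<^sub>v n"
  shows "length zs \<le> zero_reducing_multiplicity A"
proof -
  \<comment> \<open>Stacking \<open>A\<close> on its adjoint turns the intersection of the two
    kernels into the kernel of a single matrix, so the locale \<open>kernel\<close> supplies its
    dimension theory.\<close>
  let ?C = "A @\<^sub>r mat_adjoint A"
  have C: "?C \<in> carrier_mat (n + n) n" using cA by auto
  interpret kernel "n + n" n ?C by unfold_locales (fact C)
  have split: "0\<^sub>v (n + n) = 0\<^sub>v n @\<^sub>v (0\<^sub>v n :: complex vec)" by (rule eq_vecI) auto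
  have K: "mat_kernel ?C = mat_kernel A \<inter> mat_kernel (mat_adjoint A)"
    unfolding mat_kernel[OF C] mat_kernel[OF cA] mat_kernel[OF mat_adjoint_carrier[OF cA]] split
    using cA mat_mult_append[OF cA mat_adjoint_carrier[OF cA]]
    by (auto simp: append_vec_eq[of _ n])
  have zK: "set zs \<subseteq> mat_kernel ?C"
    using z orthonormal_carrier[OF o]
    unfolding K mat_kernel[OF cA] mat_kernel[OF mat_adjoint_carrier[OF cA]] by auto
  obtain ys where ys: "length ys = n - length zs" "orthonormal n (zs @ ys)"
    using orthonormal_extend[OF o, of "[]" "n - length zs"] orthonormal_length[OF o] by auto
  have l: "length (zs @ ys) = n" using ys orthonormal_length[OF o] by simp
  have c: "set (zs @ ys) \<subseteq> carrier_vec n" using orthonormal_carrier[OF ys(2)] .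
  let ?U = "mat_of_cols n (zs @ ys)"
  have U: "?U \<in> carrier_mat n n" using l by (metis mat_of_cols_carrier(1))
  have "det (?U * mat_adjoint ?U) = 1" unfolding orthonormal_basis_unitary[OF ys(2) l] by simp
  hence "det ?U * det (mat_adjoint ?U) = 1"
    using det_mult[OF U mat_adjoint_carrier[OF U]] by metis
  \<comment> \<open>Independence of \<open>zs\<close> comes from its completion to a basis: the
    unitary \<open>?U\<close> has nonzero determinant, and the transpose presents the basis vectors
    as rows.\<close>
  hence "det (?U\<^sup>T) \<noteq> 0" using det_transpose[OF U] by auto
  hence "NC.lin_indpt (set (rows (?U\<^sup>T)))"
    by (intro NC.det_not_0_imp_lin_indpt_rows) (use U in auto)
  hence "NC.lin_indpt (set (zs @ ys))" using c by simp
  hence "NC.lin_indpt (set zs)" by (rule NC.subset_li_is_li) auto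
  hence li: "lin_indpt (set zs)" using lindep_same[OF zK] by simp
  obtain B where "finite B" "basis B" using kernel_basis_exists[OF C] by blast
  hence fd: "Ker.fin_dim" unfolding Ker.fin_dim_def Ker.basis_def by auto
  have "distinct zs"
    unfolding distinct_conv_nth using orthonormal_nth[OF o] by (metis zero_neq_one)
  hence "length zs = card (set zs)" by (simp add: distinct_card)
  also have "\<dots> \<le> dim" using Ker.li_le_dim(2)[OF fd _ li] zK by simp
  also have "dim = zero_reducing_multiplicity A"
    using cA unfolding zero_reducing_multiplicity_def K by simp
  finally show ?thesis .
qed

lemma unitarily_similar_compression:
  assumes A: "A \<in> carrier_mat n n" and o: "orthonormal n xs" and l: "length xs = n"
  defines "U \<equiv> mat_of_cols n xs"
  shows "unitarily_similar A (mat_adjoint U * A * U)"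
proof -
  have U: "U \<in> carrier_mat n n" using l by (auto simp: U_def)
  note U' = mat_adjoint_carrier[OF U]
  have 1: "U * mat_adjoint U = 1\<^sub>m n"
    unfolding U_def by (rule orthonormal_basis_unitary[OF o l])
  have 2: "mat_adjoint U * U = 1\<^sub>m n"
    using o l orthonormal_iff_isometry[OF orthonormal_carrier[OF o]] by (simp add: U_def)
  have "U * (mat_adjoint U * A * U) = U * (mat_adjoint U * A) * U"
    by (rule assoc_mult_mat[symmetric, of _ n n _ n _ n]) (use A U U' in auto)
  also have "U * (mat_adjoint U * A) = U * mat_adjoint U * A"
    by (rule assoc_mult_mat[symmetric, OF U U' A])
  finally have "U * (mat_adjoint U * A * U) * mat_adjoint U = A * (U * mat_adjoint U)"
    using assoc_mult_mat[OF A U U'] A by (simp add: 1)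
  hence eq: "A = U * (mat_adjoint U * A * U) * mat_adjoint U" using A by (simp add: 1)
  thus ?thesis
    unfolding unitarily_similar_def similar_mat_wit_def Let_def
    using A U U' 1 2 by (intro exI[of _ U] conjI eq) auto
qed

text \<open>\<open>X\<close> maps isometrically into the complement of \<open>zs\<close> and carries
  the form of the compressed matrix to that of \<open>A\<close>. A pair that involves some
  \<open>z\<close> in \<open>zs\<close> contributes zero, by \<open>A z = 0\<close> in the first
  argument and by the adjoint in the second. This serves to bound the index of a compression from
  above.\<close>

lemma zero_compression_join_kernel:
  assumes A: "A \<in> carrier_mat n n" and o: "orthonormal n (xs @ zs)"
    and z: "\<And>z. z \<in> set zs \<Longrightarrow> A *\<^sub>v z = 0\<^sub>v n \<and> mat_adjoint A *\<^sub>v z = 0\<^sub>v n"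
  defines "X \<equiv> mat_of_cols n xs"
  assumes c: "zero_compression (mat_adjoint X * A * X) l"
  shows "zero_compression A (l + length zs)"
proof -
  define p where "p = length xs"
  have X: "X \<in> carrier_mat n p" by (simp add: X_def p_def)
  note X' = mat_adjoint_carrier[OF X]
  have oxz: "orthonormal n xs" "orthonormal n zs" and xz: "\<forall>x \<in> set xs. \<forall>z \<in> set zs. x \<bullet>c z = 0"
    using o by (auto simp: orthonormal_append)
  note cx = orthonormal_carrier[OF oxz(1)] and cz = orthonormal_carrier[OF oxz(2)]
  have iso: "mat_adjoint X * X = 1\<^sub>m p"
    using oxz(1) orthonormal_iff_isometry[OF cx] by (simp add: X_def p_def)
  have "mat_adjoint X * A * X \<in> carrier_mat p p" using X X' A by auto
  then obtain us where us: "length us = l" "orthonormal p us"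
    "\<forall>u \<in> set us. \<forall>u' \<in> set us. (mat_adjoint X * A * X *\<^sub>v u) \<bullet>c u' = 0"
    using c unfolding zero_compression_iff_orthonormal[OF \<open>mat_adjoint X * A * X \<in> carrier_mat p p\<close>] by blast
  note cu = orthonormal_carrier[OF us(2)]
  have inner: "(X *\<^sub>v a) \<bullet>c (X *\<^sub>v b) = a \<bullet>c b" if "a \<in> carrier_vec p" "b \<in> carrier_vec p" for a b
  proof -
    have "(X *\<^sub>v a) \<bullet>c (X *\<^sub>v b) = a \<bullet>c (mat_adjoint X *\<^sub>v (X *\<^sub>v b))"
      using that X by (intro cscalar_prod_mult_mat_vec[OF X]) auto
    also have "mat_adjoint X *\<^sub>v (X *\<^sub>v b) = mat_adjoint X * X *\<^sub>v b"
      using X X' that by (intro assoc_mult_mat_vec[symmetric]) auto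
    finally show ?thesis using that by (simp add: iso)
  qed
  have form: "(A *\<^sub>v (X *\<^sub>v a)) \<bullet>c (X *\<^sub>v b) = (mat_adjoint X * A * X *\<^sub>v a) \<bullet>c b"
    if "a \<in> carrier_vec p" "b \<in> carrier_vec p" for a b
  proof -
    have Xa: "X *\<^sub>v a \<in> carrier_vec n" using X that by simp
    have AXa: "A *\<^sub>v (X *\<^sub>v a) \<in> carrier_vec n" using A Xa by simp
    have "mat_adjoint X * A * X *\<^sub>v a = mat_adjoint X * A *\<^sub>v (X *\<^sub>v a)"
      using X X' A that by (intro assoc_mult_mat_vec) auto
    also have "\<dots> = mat_adjoint X *\<^sub>v (A *\<^sub>v (X *\<^sub>v a))"
      by (rule assoc_mult_mat_vec[OF X' A Xa])
    finally show ?thesis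
      using cscalar_prod_mult_mat_vec[OF X' AXa that(2)] by simp
  qed
  have perp: "(X *\<^sub>v a) \<bullet>c z = 0" if "a \<in> carrier_vec p" "z \<in> set zs" for a z
  proof -
    have z': "z \<in> carrier_vec n" using that cz by auto
    have "mat_adjoint X *\<^sub>v z = 0\<^sub>v p"
    proof (rule eq_vecI)
      fix i assume "i < dim_vec (0\<^sub>v p :: complex vec)"
      hence i: "i < p" by simp
      have xi: "xs ! i \<in> set xs" using i by (simp add: p_def)
      hence "z \<bullet>c xs ! i = 0"
        using xz that(2) cx z' by - (rule cscalar_prod_commute_0[of "xs ! i" n z], auto)
      moreover have "col X i = xs ! i"
        unfolding X_def using i xi cx by (intro col_mat_of_cols) (auto simp: p_def)
      ultimately show "(mat_adjoint X *\<^sub>v z) $ i = 0\<^sub>v p $ i"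
        using mat_adjoint_mult_vec_index[OF X z' i] i by simp
    qed (use X in auto)
    thus ?thesis using cscalar_prod_mult_mat_vec[OF X that(1) z'] that by simp
  qed
  let ?vs = "map ((*\<^sub>v) X) us"
  have cv: "set ?vs \<subseteq> carrier_vec n" using X cu by auto
  have "orthonormal n ?vs"
    unfolding orthonormal_def
  proof (intro conjI allI impI)
    fix i j assume "i < length ?vs" "j < length ?vs"
    thus "?vs ! i \<bullet>c ?vs ! j = (if i = j then 1 else 0)"
      using inner[of "us ! i" "us ! j"] orthonormal_nth[OF us(2), of i j] cu by (simp add: subset_iff)
  qed (fact cv)
  hence "orthonormal n (?vs @ zs)"
    using oxz(2) perp cu by (auto simp: orthonormal_append)
  moreover have "(A *\<^sub>v v) \<bullet>c v' = 0" if v: "v \<in> set (?vs @ zs)" "v' \<in> set (?vs @ zs)" for v v'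
  proof -
    have vv': "v \<in> carrier_vec n" "v' \<in> carrier_vec n" using v cv cz by auto
    consider "v \<in> set zs" | "v' \<in> set zs" | "v \<in> set ?vs" "v' \<in> set ?vs" using v by auto
    thus ?thesis
    proof cases
      case 1
      thus ?thesis using z vv' by simp
    next
      case 2
      thus ?thesis using z vv' cscalar_prod_mult_mat_vec[OF A vv'] by simp
    next
      case 3
      then obtain u u' where "u \<in> set us" "u' \<in> set us" "v = X *\<^sub>v u" "v' = X *\<^sub>v u'" by auto
      thus ?thesis using form[of u u'] us(3) cu by (simp add: subset_iff)
    qed
  qed
  ultimately show ?thesis
    unfolding zero_compression_iff_orthonormal[OF A]
    using us(1) by (intro exI[of _ "?vs @ zs"]) simp
qed

section \<open>The common kernel and a basis adapted to it\<close>

lemma common_kernel_orthonormal: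
  assumes A: "A \<in> carrier_mat n n" and d: "zero_compression A d" and n: "2 * n \<le> 3 * d"
  shows "\<exists>ys ws zs. orthonormal n (ys @ ws @ zs) \<and>
    length ys = 2 * (n - d) \<and> length ws = n - d \<and> length zs = 3 * d - 2 * n \<and>
    (\<forall>z \<in> set zs. A *\<^sub>v z = 0\<^sub>v n \<and> mat_adjoint A *\<^sub>v z = 0\<^sub>v n) \<and>
    (\<forall>y \<in> set ys. \<forall>y' \<in> set ys. (A *\<^sub>v y) \<bullet>c y' = 0)"
proof -
  note A' = mat_adjoint_carrier[OF A]
  have dn: "d \<le> n" using zero_compression_le[OF A d] .
  obtain vs where vs: "length vs = d" "orthonormal n vs"
    and vs0: "\<And>v v'. v \<in> set vs \<Longrightarrow> v' \<in> set vs \<Longrightarrow> (A *\<^sub>v v) \<bullet>c v' = 0"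
    using d unfolding zero_compression_iff_orthonormal[OF A] by blast
  obtain ws where ws: "length ws = n - d" "orthonormal n (vs @ ws)"
    using orthonormal_extend[OF vs(2), of "[]" "n - d"] vs dn by auto
  have l: "length (vs @ ws) = n" using vs ws dn by simp
  have ow: "orthonormal n ws" and vw: "\<And>v w. v \<in> set vs \<Longrightarrow> w \<in> set ws \<Longrightarrow> v \<bullet>c w = 0"
    using ws(2) by (auto simp: orthonormal_append)
  note cv = orthonormal_carrier[OF vs(2)] and cw = orthonormal_carrier[OF ow]
  \<comment> \<open>These \<open>3 * (n - d)\<close> vectors need not be independent. By
    \<open>2 * n <= 3 * d\<close> the truncated difference \<open>3 * d - 2 * n\<close> is exact,
    and the two numbers add up to \<open>n\<close>.\<close>
  let ?cs = "ws @ map ((*\<^sub>v) A) ws @ map ((*\<^sub>v) (mat_adjoint A)) ws"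
  have "set ?cs \<subseteq> carrier_vec n" using A A' cw by auto
  moreover have "length ?cs + length ([] :: complex vec list) + (3 * d - 2 * n) \<le> n"
    using ws(1) dn n by simp
  ultimately obtain zs where zs: "length zs = 3 * d - 2 * n" "orthonormal n zs"
    and z0: "\<forall>z \<in> set zs. \<forall>c \<in> set ?cs. z \<bullet>c c = 0"
    using orthonormal_extend[OF orthonormal_Nil, of ?cs n "3 * d - 2 * n"] by auto
  note cz = orthonormal_carrier[OF zs(2)]
  have zw: "z \<bullet>c w = 0" "z \<bullet>c (A *\<^sub>v w) = 0" "z \<bullet>c (mat_adjoint A *\<^sub>v w) = 0"
    if "z \<in> set zs" "w \<in> set ws" for z w
    using z0 that by auto
  have span: "(A *\<^sub>v y) \<bullet>c y' = 0"
    if "y \<in> carrier_vec n" "\<And>w. w \<in> set ws \<Longrightarrow> y \<bullet>c w = 0"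
      "y' \<in> carrier_vec n" "\<And>w. w \<in> set ws \<Longrightarrow> y' \<bullet>c w = 0" for y y'
    by (rule compression_on_span[OF A ws(2) l]) (fact vs0 that)+
  have "A *\<^sub>v z = 0\<^sub>v n \<and> mat_adjoint A *\<^sub>v z = 0\<^sub>v n" if z: "z \<in> set zs" for z
  proof
    have z': "z \<in> carrier_vec n" using z cz by auto
    show "A *\<^sub>v z = 0\<^sub>v n"
    proof (rule orthonormal_basis_eq_0[OF ws(2) l])
      fix x assume x: "x \<in> set (vs @ ws)"
      hence x': "x \<in> carrier_vec n" using cv cw by auto
      show "(A *\<^sub>v z) \<bullet>c x = 0"
      proof (cases "x \<in> set ws")
        case True
        thus ?thesis using zw(3)[OF z] cscalar_prod_mult_mat_vec[OF A z' x'] by simp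
      next
        case False
        hence "x \<in> set vs" using x by simp
        show ?thesis
          using span[OF z' _ x'] zw(1)[OF z] vw[OF \<open>x \<in> set vs\<close>] by simp
      qed
    qed (use A z' in auto)
    show "mat_adjoint A *\<^sub>v z = 0\<^sub>v n"
    proof (rule orthonormal_basis_eq_0[OF ws(2) l])
      fix x assume x: "x \<in> set (vs @ ws)"
      hence x': "x \<in> carrier_vec n" using cv cw by auto
      have "z \<bullet>c (A *\<^sub>v x) = 0"
      proof (cases "x \<in> set ws")
        case True
        thus ?thesis using zw(2)[OF z] by simp
      next
        case False
        hence "x \<in> set vs" using x by simp
        have "(A *\<^sub>v x) \<bullet>c z = 0"
          using span[OF x' _ z'] zw(1)[OF z] vw[OF \<open>x \<in> set vs\<close>] by simp
        thus ?thesis using A x' z' by - (rule cscalar_prod_commute_0[of _ n], auto)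
      qed
      thus "(mat_adjoint A *\<^sub>v z) \<bullet>c x = 0"
        using cscalar_prod_mult_mat_vec[OF A' z' x'] by simp
    qed (use A' z' in auto)
  qed
  note kernel = this
  have "w \<bullet>c z = 0" if "w \<in> set ws" "z \<in> set zs" for w z
    using zw(1)[OF that(2,1)] that cw cz by - (rule cscalar_prod_commute_0[of z n], auto)
  hence "orthonormal n (ws @ zs)" using ow zs(2) by (simp add: orthonormal_append)
  moreover have "length ([] :: complex vec list) + length (ws @ zs) + 2 * (n - d) \<le> n"
    using ws(1) zs(1) dn n by simp
  \<comment> \<open>The family \<open>vs\<close> is not adapted to \<open>zs\<close>, so new vectors
    are chosen. Being orthogonal to \<open>ws\<close>, they lie in the span of \<open>vs\<close>,
    where the form of \<open>A\<close> vanishes by \<open>span\<close>.\<close>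
  ultimately obtain ys where ys: "length ys = 2 * (n - d)" "orthonormal n ((ws @ zs) @ ys)"
    using orthonormal_extend[of n "ws @ zs" "[]" "2 * (n - d)"] by auto
  have o: "orthonormal n (ys @ ws @ zs)" using orthonormal_swap[OF ys(2)] .
  have "(A *\<^sub>v y) \<bullet>c y' = 0" if "y \<in> set ys" "y' \<in> set ys" for y y'
  proof -
    have "x \<in> carrier_vec n" "\<And>w. w \<in> set ws \<Longrightarrow> x \<bullet>c w = 0" if "x \<in> set ys" for x
      using that o orthonormal_carrier[OF o] by (auto simp: orthonormal_append)
    note perp = this
    show ?thesis
      using span[OF perp(1)[OF that(1)] _ perp(1)[OF that(2)]] perp(2) that by simp
  qed
  with o kernel show ?thesis
    using ys(1) ws(1) zs(1) by - (rule exI[of _ ys], rule exI[of _ ws], rule exI[of _ zs], simp)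
qed

section \<open>Splitting off the zero block\<close>

lemma large_zero_dilation_index:
  assumes A: "A \<in> carrier_mat n n"
  defines "d \<equiv> zero_dilation_index A"
  assumes d: "(2 * n) div 3 < d"
  shows "zero_reducing_eigenvalue A" "3 * d - 2 * n \<le> zero_reducing_multiplicity A"
    "\<exists>B \<in> carrier_mat (3 * (n - d)) (3 * (n - d)). zero_dilation_index B = 2 * (n - d) \<and>
      unitarily_similar A (diag_block_mat [B, 0\<^sub>m (3 * d - 2 * n) (3 * d - 2 * n)])"
proof -
  define m k where "m = n - d" and "k = 3 * d - 2 * n"
  have c: "zero_compression A d" unfolding d_def by (rule zero_compression_index[OF A])
  \<comment> \<open>Exceeding the floor means \<open>2 * n < 3 * d\<close> for integers, so
    \<open>k\<close> is positive and \<open>zs ! 0\<close> below exists.\<close>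
  have nd: "2 * n < 3 * d" "d \<le> n" using d zero_compression_le[OF A c] by auto
  obtain ys ws zs where o: "orthonormal n (ys @ ws @ zs)"
    and l: "length ys = 2 * m" "length ws = m" "length zs = k"
    and z: "\<And>z. z \<in> set zs \<Longrightarrow> A *\<^sub>v z = 0\<^sub>v n \<and> mat_adjoint A *\<^sub>v z = 0\<^sub>v n"
    and y: "\<And>y y'. y \<in> set ys \<Longrightarrow> y' \<in> set ys \<Longrightarrow> (A *\<^sub>v y) \<bullet>c y' = 0"
    unfolding m_def k_def using common_kernel_orthonormal[OF A c] nd by fastforce
  have oz: "orthonormal n zs" using o by (simp add: orthonormal_append)
  have "zs ! 0 \<in> set zs" "zs ! 0 \<bullet>c zs ! 0 = 1"
    using orthonormal_nth[OF oz, of 0 0] l(3) nd by (auto simp: k_def)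
  moreover from this have "zs ! 0 \<in> carrier_vec n" "zs ! 0 \<noteq> 0\<^sub>v n"
    using orthonormal_carrier[OF oz] by auto
  ultimately show "zero_reducing_eigenvalue A"
    using z A unfolding zero_reducing_eigenvalue_def by auto
  show "3 * d - 2 * n \<le> zero_reducing_multiplicity A"
    using zero_reducing_multiplicity_ge[OF A oz z] l(3) by (simp add: k_def)
  define xs where "xs = ys @ ws"
  define X where "X = mat_of_cols n xs"
  define B where "B = mat_adjoint X * A * X"
  have o': "orthonormal n (xs @ zs)" using o by (simp add: xs_def)
  have lx: "length xs = 3 * m" using l by (simp add: xs_def)
  have ln: "length (xs @ zs) = n" using lx l(3) nd by (simp add: m_def k_def)
  have X: "X \<in> carrier_mat n (3 * m)" unfolding X_def lx[symmetric] by simp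
  have B: "B \<in> carrier_mat (3 * m) (3 * m)" using X A by (auto simp: B_def)
  have cx: "set (xs @ zs) \<subseteq> carrier_vec n" using orthonormal_carrier[OF o'] .
  have colX: "col X i = xs ! i" if "i < 3 * m" for i
    unfolding X_def using that lx cx by (intro col_mat_of_cols) auto
  have Bij: "B $$ (i, j) = (A *\<^sub>v xs ! j) \<bullet>c xs ! i" if "i < 3 * m" "j < 3 * m" for i j
    unfolding B_def using compression_index[OF A X that] colX that by simp
  have "zero_dilation_index B \<le> 2 * m"
  proof -
    \<comment> \<open>Since \<open>d = 2 * m + k\<close>, a compression of \<open>B\<close> of size
      above \<open>2 * m\<close> would exceed \<open>d\<close> once the \<open>k\<close> kernel
      vectors are joined to it.\<close>
    have "zero_compression A (zero_dilation_index B + k)"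
      using zero_compression_join_kernel[OF A o' z] zero_compression_index[OF B] l(3)
      by (simp add: B_def X_def)
    hence "zero_dilation_index B + k \<le> d"
      unfolding d_def by (rule zero_compression_le_index[OF A])
    thus ?thesis using nd by (simp add: m_def k_def)
  qed
  moreover have "2 * m \<le> zero_dilation_index B"
  proof (rule zero_compression_le_index[OF B])
    \<comment> \<open>The list \<open>xs\<close> starts with \<open>ys\<close>, so the leading block
      of \<open>B\<close> of size \<open>2 * m\<close> is zero.\<close>
    let ?es = "map (unit_vec (3 * m)) [0..<2 * m]"
    have "orthonormal (3 * m) ?es" by (rule orthonormal_unit_vecs) simp
    moreover have "(B *\<^sub>v e) \<bullet>c e' = 0" if "e \<in> set ?es" "e' \<in> set ?es" for e e'
    proof -
      from that obtain i j where ij: "i < 2 * m" "j < 2 * m" "e = unit_vec (3 * m) j" 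
        "e' = unit_vec (3 * m) i" by auto
      have "(B *\<^sub>v e) \<bullet>c e' = B $$ (i, j)"
        using ij by (simp add: mat_form_unit_vec[OF B])
      also have "\<dots> = 0"
        using Bij[of i j] y[of "ys ! j" "ys ! i"] ij l(1) by (simp add: xs_def nth_append)
      finally show ?thesis .
    qed
    ultimately show "zero_compression B (2 * m)"
      unfolding zero_compression_iff_orthonormal[OF B] by (intro exI[of _ ?es]) simp
  qed
  moreover
  let ?U = "mat_of_cols n (xs @ zs)" and ?D = "diag_block_mat [B, 0\<^sub>m k k]"
  have U: "?U \<in> carrier_mat n n" using ln by (metis mat_of_cols_carrier(1))
  have n: "n = 3 * m + k" using ln lx l(3) by simp
  have "mat_adjoint ?U * A * ?U = ?D"
  proof (rule eq_matI)
    fix i j assume "i < dim_row ?D" "j < dim_col ?D"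
    hence ij: "i < n" "j < n" using B n by (simp_all add: dim_diag_block_mat)
    have ci: "(xs @ zs) ! i \<in> carrier_vec n" "(xs @ zs) ! j \<in> carrier_vec n"
      using cx ij ln by (metis nth_mem subsetD)+
    have col: "col ?U i = (xs @ zs) ! i" "col ?U j = (xs @ zs) ! j"
      using col_mat_of_cols[OF _ ci(1)] col_mat_of_cols[OF _ ci(2)] ij ln by auto
    have "(mat_adjoint ?U * A * ?U) $$ (i, j) = (A *\<^sub>v (xs @ zs) ! j) \<bullet>c (xs @ zs) ! i"
      using compression_index[OF A U ij] col by simp
    \<comment> \<open>Columns from index \<open>3 * m\<close> on vanish because \<open>A\<close>
      kills \<open>zs\<close>, rows from there on because the adjoint does.\<close>
    also have "\<dots> = (if i < 3 * m \<and> j < 3 * m then B $$ (i, j) else 0)"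
    proof (cases "j < 3 * m")
      case False
      hence "(xs @ zs) ! j \<in> set zs" using ij n lx l(3) by (simp add: nth_append)
      thus ?thesis using z False ci by simp
    next
      case True
      note j = this
      show ?thesis
      proof (cases "i < 3 * m")
        case False
        hence "(xs @ zs) ! i \<in> set zs" using ij n lx l(3) by (simp add: nth_append)
        thus ?thesis using z False cscalar_prod_mult_mat_vec[OF A ci(2,1)] ci by simp
      qed (use Bij j lx in \<open>simp add: nth_append\<close>)
    qed
    also have "\<dots> = ?D $$ (i, j)" using ij n B by auto
    finally show "(mat_adjoint ?U * A * ?U) $$ (i, j) = ?D $$ (i, j)" .
  qed (use B n U in \<open>auto simp: dim_diag_block_mat\<close>)
  hence "unitarily_similar A ?D"
    using unitarily_similar_compression[OF A o' ln] by simp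
  ultimately show "\<exists>B \<in> carrier_mat (3 * (n - d)) (3 * (n - d)). zero_dilation_index B = 2 * (n - d) \<and>
      unitarily_similar A (diag_block_mat [B, 0\<^sub>m (3 * d - 2 * n) (3 * d - 2 * n)])"
    using B unfolding m_def k_def by (intro bexI[of _ B]) auto
qed

section \<open>Sharpness of the bound\<close>

lemma index_without_reducing_eigenvalue:
  assumes "n \<ge> 1"
  shows "\<exists>A \<in> carrier_mat n n. zero_dilation_index A = (2 * n) div 3 \<and> \<not> zero_reducing_eigenvalue A"
proof -
  define d where "d = (2 * n) div 3"
  define m where "m = n - d"
  \<comment> \<open>Here \<open>m\<close> is \<open>n / 3\<close> rounded up. The only case with
    \<open>d < m\<close> is \<open>n = 1\<close>, where \<open>d = 0\<close>.\<close>
  have dm: "n = d + m" "d \<le> 2 * m" "m \<ge> 1" "d < m \<Longrightarrow> n = 1"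
    using assms by (auto simp: d_def m_def)
  \<comment> \<open>The blocks are \<open>0\<close> and \<open>P\<close> above \<open>Q\<close> and \<open>I\<^sub>m\<close>, where \<open>P z = 0\<close> forces \<open>z = 0\<close> and
    \<open>P\<^sup>* y = 0\<close>, \<open>Q y = 0\<close> kill the entries of \<open>y\<close> below and from index \<open>m\<close>; the \<open>I\<^sub>m\<close> matters
    only for \<open>n = 1\<close>, where \<open>P\<close> and \<open>Q\<close> are empty.\<close>
  define A :: "complex mat" where "A = mat n n (\<lambda>(i, j).
    if i < d \<and> j < d then 0 else if i < d then (if j = d + i then 1 else 0)
    else if j < d then (if i + m = j + d then 1 else 0) else (if i = j then 1 else 0))"
  have A: "A \<in> carrier_mat n n" by (simp add: A_def)
  have red: "\<not> zero_reducing_eigenvalue A"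
  proof
    assume "zero_reducing_eigenvalue A"
    then obtain x where x: "x \<in> carrier_vec n" "x \<noteq> 0\<^sub>v n" "A *\<^sub>v x = 0\<^sub>v n"
      "mat_adjoint A *\<^sub>v x = 0\<^sub>v n" using A by (auto simp: zero_reducing_eigenvalue_def)
    have row: "(\<Sum>j<n. A $$ (i, j) * x $ j) = 0" if "i < n" for i
      using that arg_cong[OF x(3), of "\<lambda>v. v $ i"] A x(1)
      by (simp add: scalar_prod_def lessThan_atLeast0)
    have col: "(\<Sum>j<n. cnj (A $$ (j, i)) * x $ j) = 0" if "i < n" for i
      using that arg_cong[OF x(4), of "\<lambda>v. v $ i"] A x(1)
      by (simp add: scalar_prod_def lessThan_atLeast0)
    have lower: "x $ j = 0" if j: "d \<le> j" "j < n" for j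
    proof (cases "d < m")
      case True
      hence "d = 0" "n = 1" "j = 0" using dm j by auto
      thus ?thesis using row[of 0] by (simp add: A_def)
    next
      case False
      \<comment> \<open>Row \<open>j - d\<close> lies in the upper block, since
        \<open>j - d < m\<close> and \<open>m <= d\<close>; its only nonzero entry is in column
        \<open>j\<close>.\<close>
      have "(\<Sum>l<n. A $$ (j - d, l) * x $ l) = (\<Sum>l<n. if l = j then x $ l else 0)"
        using False j dm by (intro sum.cong) (auto simp: A_def)
      thus ?thesis using row[of "j - d"] j by simp
    qed
    have "x $ j = 0" if j: "j < n" for j
    proof -
      consider "j < d" "j < m" | "j < d" "m \<le> j" | "d \<le> j" by linarith
      thus ?thesis
      proof cases
        case 1
        \<comment> \<open>Column \<open>d + j\<close> has a 1 in row \<open>j\<close> and possibly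
          one on the diagonal; the diagonal one meets the entry of \<open>x\<close> at
          \<open>d + j\<close>, already known to be zero.\<close>
        have "(\<Sum>i<n. cnj (A $$ (i, d + j)) * x $ i) = (\<Sum>i<n. if i = j then x $ i else 0)"
          using 1 dm lower[of "d + j"] by (intro sum.cong) (auto simp: A_def)
        thus ?thesis using col[of "d + j"] j 1 dm by simp
      next
        case 2
        \<comment> \<open>The row in which the lower left block has its 1 in column
          \<open>j\<close>. It lies below the upper block by \<open>m <= j\<close>, and
          \<open>d <= 2 * m\<close> keeps it inside the matrix.\<close>
        define i where "i = j + d - m"
        have i: "i + m = j + d" "i < n" "d \<le> i" using 2 dm(1,2) by (auto simp: i_def)
        have "A $$ (i, l) * x $ l = (if l = j then x $ l else 0)" if l: "l < n" for l
        proof (cases "l < d")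
          case True
          hence "A $$ (i, l) = (if l = j then 1 else 0)" using i l by (simp add: A_def)
          thus ?thesis by simp
        next
          case False
          hence "x $ l = 0" "l \<noteq> j" using lower l 2 by auto
          thus ?thesis by simp
        qed
        hence "(\<Sum>l<n. A $$ (i, l) * x $ l) = (\<Sum>l<n. if l = j then x $ l else 0)"
          by (intro sum.cong) auto
        thus ?thesis using row[OF i(2)] j by simp
      next
        case 3
        thus ?thesis using lower j by simp
      qed
    qed
    hence "x = 0\<^sub>v n" using x(1) by (intro eq_vecI) auto
    with x(2) show False by simp
  qed
  have "zero_dilation_index A \<le> d"
    using large_zero_dilation_index(1)[OF A] red by (fastforce simp: d_def)
  moreover have "d \<le> zero_dilation_index A"
  proof (rule zero_compression_le_index[OF A])
    let ?es = "map (unit_vec n) [0..<d]"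
    have "d \<le> n" using dm(1) by simp
    hence "orthonormal n ?es" by (rule orthonormal_unit_vecs)
    moreover have "(A *\<^sub>v e) \<bullet>c e' = 0" if "e \<in> set ?es" "e' \<in> set ?es" for e e'
    proof -
      from that obtain i j where ij: "i < d" "j < d" "e = unit_vec n j" "e' = unit_vec n i" by auto
      have "(A *\<^sub>v e) \<bullet>c e' = A $$ (i, j)" using ij \<open>d \<le> n\<close> by (simp add: mat_form_unit_vec[OF A])
      also have "\<dots> = 0" using ij dm(1) by (simp add: A_def)
      finally show ?thesis .
    qed
    ultimately show "zero_compression A d"
      unfolding zero_compression_iff_orthonormal[OF A] by (intro exI[of _ ?es]) simp
  qed
  ultimately show ?thesis using A red by (intro bexI[of _ A]) (auto simp: d_def)
qed

theorem theorem3p2: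
  shows "(\<forall>n\<ge>1. \<forall>A \<in> carrier_mat n n.
      zero_dilation_index A > (2 * n) div 3 \<longrightarrow>
        zero_reducing_eigenvalue A \<and>
        zero_reducing_multiplicity A \<ge> 3 * zero_dilation_index A - 2 * n \<and>
        (\<exists>B \<in> carrier_mat (3 * (n - zero_dilation_index A)) (3 * (n - zero_dilation_index A)).
          zero_dilation_index B = 2 * (n - zero_dilation_index A) \<and>
          unitarily_similar A
            (diag_block_mat [B, 0\<^sub>m (3 * zero_dilation_index A - 2 * n)
                                    (3 * zero_dilation_index A - 2 * n)]))) \<and>
    (\<forall>n\<ge>1. \<exists>A \<in> carrier_mat n n.
      zero_dilation_index A = (2 * n) div 3 \<and> \<not> zero_reducing_eigenvalue A)"
proof (intro conjI allI impI ballI)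
  fix n :: nat and A :: "complex mat"
  assume A: "A \<in> carrier_mat n n" and d: "(2 * n) div 3 < zero_dilation_index A"
  note large_zero_dilation_index[OF A d]
  thus "zero_reducing_eigenvalue A"
    and "3 * zero_dilation_index A - 2 * n \<le> zero_reducing_multiplicity A"
    and "\<exists>B \<in> carrier_mat (3 * (n - zero_dilation_index A)) (3 * (n - zero_dilation_index A)).
      zero_dilation_index B = 2 * (n - zero_dilation_index A) \<and>
      unitarily_similar A
        (diag_block_mat [B, 0\<^sub>m (3 * zero_dilation_index A - 2 * n)
                                (3 * zero_dilation_index A - 2 * n)])"
    by this+
qed (fact index_without_reducing_eigenvalue)

end
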